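(* Let $C\subseteq\mathbb R^d$ be a closed salient convex cone with nonempty interior. Then for any linear hyperplane $H\subseteq\mathbb R^d$ with $H\cap C=\{0\}$ and any order unit $u\in{\rm int}(C)$, there is some $\nu>0$ such that $(\nu\!\uparrow\! C)^{\max}\subseteq C^{\min}$, i.e. $(\nu\!\uparrow\! C)^{\max}_s\subseteq C^{\min}_s$ for all $s\ge1$.
   Context: ${\rm Her}_s(\mathbb C)$ denotes the Hermitian $s\times s$ matrices; $\geqslant 0$ denotes positive semidefiniteness. A convex cone $C$ is salient if $C\cap(-C)=\{0\}$. For $c\in\mathbb R^d$ and $P\in{\rm Her}_s(\mathbb C)$, $c\otimes P:=(c_1P,\ldots,c_dP)$. For a closed salient convex cone $C\subseteq\mathbb R^d$ with nonempty interior and $s\ge1$, $$C_s^{\min}:=\Big\{\sum_i c_i\otimes P_i\ \text{(finite sums)}\ \Big|\ c_i\in C,\ P_i\in{\rm Her}_s(\mathbb C),\ P_i\geqslant0\Big\},$$ $$C_s^{\max}:=\{(A_1,\ldots,A_d)\in{\rm Her}_s(\mathbb C)^d\mid (v^*A_1v,\ldots,v^*A_dv)\in C\ \text{ for all } v\in\mathbb C^s\}.$$ Given a linear hyperplane $H$ with $H\cap C=\{0\}$, an order unit $u\in{\rm int}(C)$, and $\nu>0$, the scaled cone $\nu\!\uparrow\! C$ is the conical hull (including the origin) of $\{u+\nu(x-u)\mid x\in C\cap(u+H)\}$, i.e. of the set obtained by scaling $C\cap(u+H)$ by the factor $\nu$ from the point $u$. *)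

theory Defs
  imports "HOL-Analysis.Analysis" "Jordan_Normal_Form.Schur_Decomposition"
begin

(* From here on "$" is the component of an element of 'a ^ 'd only. *)
no_notation Matrix.vec_index (infixl "$" 100)

definition Her :: "nat \<Rightarrow> complex mat set" where
  "Her s = {A \<in> carrier_mat s s. mat_adjoint A = A}"

(* The number v^* A v; it is real for Hermitian A, so taking Re loses nothing
   (herm_form_real below). *)
definition herm_form :: "complex mat \<Rightarrow> complex Matrix.vec \<Rightarrow> real" where
  "herm_form A v = Re ((A *\<^sub>v v) \<bullet>c v)"

definition psd :: "nat \<Rightarrow> complex mat \<Rightarrow> bool" where
  "psd s P \<longleftrightarrow> P \<in> Her s \<and> (\<forall>v \<in> carrier_vec s. herm_form P v \<ge> 0)"

definition salient :: "'a::real_vector set \<Rightarrow> bool" where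
  "salient C \<longleftrightarrow> C \<inter> uminus ` C = {0}"

definition linear_hyperplane :: "(real ^ 'd) set \<Rightarrow> bool" where
  "linear_hyperplane H \<longleftrightarrow> Real_Vector_Spaces.subspace H \<and> dim H + 1 = CARD('d)"

definition tensor :: "real ^ 'd \<Rightarrow> complex mat \<Rightarrow> complex mat ^ 'd" where
  "tensor c P = (\<chi> j. complex_of_real (c $ j) \<cdot>\<^sub>m P)"

(* The matrix type has no zero element independent of the size, so the sum over i < n of
   tuples of s x s matrices is written entrywise. *)
definition tuple_sum :: "nat \<Rightarrow> nat \<Rightarrow> (nat \<Rightarrow> complex mat ^ 'd) \<Rightarrow> complex mat ^ 'd" where
  "tuple_sum s n T = (\<chi> j. Matrix.mat s s (\<lambda>kl. \<Sum>i<n. (T i $ j) $$ kl))"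

definition cone_min :: "(real ^ 'd) set \<Rightarrow> nat \<Rightarrow> (complex mat ^ 'd) set" where
  "cone_min C s = {tuple_sum s n (\<lambda>i. tensor (c i) (P i)) | n c P.
     \<forall>i<n. c i \<in> C \<and> psd s (P i)}"

definition cone_max :: "(real ^ 'd) set \<Rightarrow> nat \<Rightarrow> (complex mat ^ 'd) set" where
  "cone_max C s = {A. (\<forall>j. A $ j \<in> Her s) \<and>
     (\<forall>v \<in> carrier_vec s. (\<chi> j. herm_form (A $ j) v) \<in> C)}"

(* convex_cone hull X is the set of all nonnegative combinations of elements of X,
   which contains 0 in any case. *)
definition scaled_cone ::
    "(real ^ 'd) set \<Rightarrow> real ^ 'd \<Rightarrow> real \<Rightarrow> (real ^ 'd) set \<Rightarrow> (real ^ 'd) set" where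
  "scaled_cone H u \<nu> C = convex_cone hull ((\<lambda>x. u + \<nu> *\<^sub>R (x - u)) ` (C \<inter> (+) u ` H))"

lemma herm_form_real:
  assumes "A \<in> Her s" and v: "v \<in> carrier_vec s"
  shows "complex_of_real (herm_form A v) = (A *\<^sub>v v) \<bullet>c v"
proof -
  have A: "A \<in> carrier_mat s s" and h: "mat_adjoint A = A"
    using assms(1) by (auto simp: Her_def)
  have e: "cnj (A $$ (i, j)) = A $$ (j, i)" if "i < s" "j < s" for i j
  proof -
    have "A $$ (j, i) = mat_adjoint A $$ (j, i)" by (simp add: h)
    also have "\<dots> = cnj (A $$ (i, j))"
      using that A by (auto simp: mat_adjoint_def mat_of_rows_def)
    finally show ?thesis by simp
  qed
  define f where "f i = vec_index v i" for i
  have q: "(A *\<^sub>v v) \<bullet>c v = (\<Sum>i<s. \<Sum>j<s. A $$ (i, j) * f j * cnj (f i))"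
    using A v by (simp add: scalar_prod_def f_def sum_distrib_right lessThan_atLeast0)
  have "cnj ((A *\<^sub>v v) \<bullet>c v) = (\<Sum>i<s. \<Sum>j<s. A $$ (j, i) * cnj (f j) * f i)"
    unfolding q by (simp add: e)
  also have "\<dots> = (\<Sum>j<s. \<Sum>i<s. A $$ (j, i) * cnj (f j) * f i)"
    by (rule sum.swap)
  also have "\<dots> = (A *\<^sub>v v) \<bullet>c v"
    unfolding q by (simp add: mult_ac)
  finally show ?thesis
    unfolding herm_form_def by (simp add: complex_eq_iff)
qed

end

theory Submission
  imports Defs
begin

text \<open>
  The identity map from the scaled cone to \<open>C\<close> factors through a positive orthant: with
  \<open>a\<close> normal to \<open>H\<close>, \<open>a \<bullet> u = 1\<close>, and \<open>u \<plusminus> \<delta> e\<^sub>j \<in> C\<close>, every \<open>y\<close> is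
  \<open>\<Sum>\<^sub>j\<^sub>,\<^sub>\<plusminus> \<onehalf>((a \<bullet> y) / d \<plusminus> (y\<^sub>j - (a \<bullet> y) u\<^sub>j) / \<delta>) (u \<plusminus> \<delta> e\<^sub>j)\<close>. The coefficients are
  nonnegative on the scaled cone as soon as \<open>\<nu>\<close> is small, because \<open>C \<inter> (u + H)\<close> is bounded.
  Such a factorization applies verbatim to tuples of Hermitian matrices.
\<close>

section \<open>Tuples of matrices under real functionals\<close>

no_notation scalar_prod (infix "\<bullet>" 70)

text \<open>This is the functional \<open>w\<close> tensored with the identity on matrices. It is
  written entrywise for the same reason as \<open>tuple_sum\<close>.\<close>

definition real_comb :: "nat \<Rightarrow> real ^ 'd \<Rightarrow> complex mat ^ 'd \<Rightarrow> complex mat" where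
  "real_comb s w A = Matrix.mat s s (\<lambda>kl. \<Sum>j\<in>UNIV. complex_of_real (w $ j) * (A $ j) $$ kl)"

lemma Her_iff: "A \<in> Her s \<longleftrightarrow>
    A \<in> carrier_mat s s \<and> (\<forall>i<s. \<forall>j<s. cnj (A $$ (i, j)) = A $$ (j, i))"
proof -
  have "mat_adjoint A = A \<longleftrightarrow> (\<forall>i<s. \<forall>j<s. cnj (A $$ (i, j)) = A $$ (j, i))"
    if "A \<in> carrier_mat s s"
    using that unfolding mat_eq_iff by (auto simp: mat_adjoint_def mat_of_rows_def)
  then show ?thesis
    unfolding Her_def by blast
qed

lemma real_comb_Her: "real_comb s w A \<in> Her s" if "\<And>j. A $ j \<in> Her s"
  using that unfolding Her_iff real_comb_def by simp

lemma herm_form_expand: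
  assumes "A \<in> carrier_mat s s" "v \<in> carrier_vec s"
  shows "herm_form A v =
    Re (\<Sum>k<s. \<Sum>l<s. A $$ (k, l) * vec_index v l * cnj (vec_index v k))"
  using assms
  by (simp add: herm_form_def scalar_prod_def sum_distrib_right lessThan_atLeast0)

text \<open>Applying \<open>w\<close> and evaluating the form at \<open>v\<close> act on different
  tensor factors and therefore commute.\<close>

lemma herm_form_real_comb:
  fixes A :: "complex mat ^ 'd"
  assumes A: "\<And>j. A $ j \<in> carrier_mat s s" and v: "v \<in> carrier_vec s"
  shows "herm_form (real_comb s w A) v = w \<bullet> (\<chi> j. herm_form (A $ j) v)"
proof -
  let ?t = "\<lambda>j k l. (A $ j) $$ (k, l) * vec_index v l * cnj (vec_index v k)"
  have "(\<Sum>k<s. \<Sum>l<s. real_comb s w A $$ (k, l) * vec_index v l * cnj (vec_index v k))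
      = (\<Sum>k<s. \<Sum>l<s. \<Sum>j\<in>UNIV. complex_of_real (w $ j) * ?t j k l)"
    by (simp add: real_comb_def sum_distrib_right mult.assoc)
  also have "\<dots> = (\<Sum>k<s. \<Sum>j\<in>UNIV. \<Sum>l<s. complex_of_real (w $ j) * ?t j k l)"
    by (intro sum.cong refl sum.swap)
  also have "\<dots> = (\<Sum>j\<in>UNIV. complex_of_real (w $ j) * (\<Sum>k<s. \<Sum>l<s. ?t j k l))"
    by (subst sum.swap) (simp only: sum_distrib_left)
  finally have "herm_form (real_comb s w A) v
      = Re (\<Sum>j\<in>UNIV. complex_of_real (w $ j) * (\<Sum>k<s. \<Sum>l<s. ?t j k l))"
    using v by (subst herm_form_expand[of _ s]) (auto simp: real_comb_def)
  also have "\<dots> = (\<Sum>j\<in>UNIV. w $ j * herm_form (A $ j) v)"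
    by (simp add: herm_form_expand[OF A v] del: Re_sum) simp
  finally show ?thesis
    by (simp add: inner_vec_def)
qed

text \<open>The form of the combination at \<open>v\<close> is \<open>w\<close> paired with the
  vector of forms of \<open>A\<close>, which lies in \<open>D\<close> by definition of
  \<open>cone_max\<close>.\<close>

lemma psd_real_comb:
  assumes "A \<in> cone_max D s" "\<And>y. y \<in> D \<Longrightarrow> 0 \<le> w \<bullet> y"
  shows "psd s (real_comb s w A)"
proof -
  have "A $ j \<in> Her s" for j
    using assms(1) by (simp add: cone_max_def)
  moreover from this have "A $ j \<in> carrier_mat s s" for j
    by (simp add: Her_def)
  ultimately show ?thesis
    using assms by (simp add: psd_def real_comb_Her herm_form_real_comb cone_max_def)
qed

text \<open>Any finite index set may replace the initial segments of \<open>cone_min\<close>; pairs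
  of a coordinate and a sign will serve as indices.\<close>

lemma cone_minI:
  fixes c :: "'i \<Rightarrow> real ^ 'd"
  assumes "finite I"
    and cP: "\<And>i. i \<in> I \<Longrightarrow> c i \<in> C" "\<And>i. i \<in> I \<Longrightarrow> psd s (P i)"
    and A: "\<And>j. A $ j \<in> carrier_mat s s"
      "\<And>j k l. k < s \<Longrightarrow> l < s \<Longrightarrow>
        (A $ j) $$ (k, l) = (\<Sum>i\<in>I. complex_of_real (c i $ j) * P i $$ (k, l))"
  shows "A \<in> cone_min C s"
proof -
  obtain b where b: "bij_betw b {0..<card I} I"
    using ex_bij_betw_nat_finite[OF \<open>finite I\<close>] by blast
  have bI: "b i \<in> I" if "i < card I" for i
    using bij_betwE[OF b] that by simp
  have "tuple_sum s (card I) (\<lambda>i. tensor (c (b i)) (P (b i))) = A"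
  proof (rule iffD2[OF Finite_Cartesian_Product.vec_eq_iff], intro allI eq_matI)
    fix j k l
    assume "k < dim_row (A $ j)" "l < dim_col (A $ j)"
    then have kl: "k < s" "l < s"
      using A(1)[of j] by auto
    have P: "P (b i) \<in> carrier_mat s s" if "i < card I" for i
      using cP(2)[OF bI[OF that]] by (simp add: psd_def Her_def)
    have "(tuple_sum s (card I) (\<lambda>i. tensor (c (b i)) (P (b i))) $ j) $$ (k, l)
        = (\<Sum>i<card I. complex_of_real (c (b i) $ j) * P (b i) $$ (k, l))"
      unfolding tuple_sum_def tensor_def using kl
      by (auto dest: P intro!: sum.cong)
    also have "\<dots> = (A $ j) $$ (k, l)"
      using sum.reindex_bij_betw[OF b, of "\<lambda>i. complex_of_real (c i $ j) * P i $$ (k, l)"]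
      by (simp add: A(2)[OF kl] lessThan_atLeast0)
    finally show "(tuple_sum s (card I) (\<lambda>i. tensor (c (b i)) (P (b i))) $ j) $$ (k, l)
        = (A $ j) $$ (k, l)" .
  qed (simp_all add: tuple_sum_def carrier_matD[OF A(1)])
  then show ?thesis
    unfolding cone_min_def using cP bI
    by (intro CollectI exI[of _ "card I"] exI[of _ "\<lambda>i. c (b i)"] exI[of _ "\<lambda>i. P (b i)"]) simp
qed

text \<open>The coefficients \<open>w i \<bullet> y\<close> turn into the matrices
  \<open>real_comb s (w i) A\<close>, positive semidefinite by \<open>psd_real_comb\<close>, and
  their tensors with the \<open>c i\<close> sum to \<open>A\<close>.\<close>

lemma cone_max_subset_cone_min_factor:
  fixes c w :: "'i \<Rightarrow> real ^ 'd"
  assumes "finite I"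
    and "\<And>i. i \<in> I \<Longrightarrow> c i \<in> C"
    and "\<And>i y. i \<in> I \<Longrightarrow> y \<in> D \<Longrightarrow> 0 \<le> w i \<bullet> y"
    and id: "\<And>y. (\<Sum>i\<in>I. (w i \<bullet> y) *\<^sub>R c i) = y"
  shows "cone_max D s \<subseteq> cone_min C s"
proof
  fix A
  assume A: "A \<in> cone_max D s"
  \<comment> \<open>On basis vectors, \<open>id\<close> becomes an identity between real numbers,
    which can then multiply complex matrix entries.\<close>
  have delta: "(\<Sum>i\<in>I. c i $ j * w i $ m) = (if j = m then 1 else 0)" for j m
    using arg_cong[OF id[of "axis m 1"], of "\<lambda>y. y $ j"]
    by (simp add: inner_axis mult.commute) (simp add: axis_def)
  show "A \<in> cone_min C s"
  proof (rule cone_minI[OF \<open>finite I\<close> assms(2)])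
    show "psd s (real_comb s (w i) A)" if "i \<in> I" for i
      using psd_real_comb[OF A] assms(3)[OF that] by blast
    show "A $ j \<in> carrier_mat s s" for j
      using A by (auto simp: cone_max_def Her_def)
    fix j k l
    assume kl: "k < s" "l < s"
    have "(\<Sum>i\<in>I. complex_of_real (c i $ j) * real_comb s (w i) A $$ (k, l))
        = (\<Sum>m\<in>UNIV. \<Sum>i\<in>I. complex_of_real (c i $ j * w i $ m) * (A $ m) $$ (k, l))"
      using kl by (subst sum.swap) (simp add: real_comb_def sum_distrib_left mult.assoc)
    also have "\<dots> = (\<Sum>m\<in>UNIV. complex_of_real (if j = m then 1 else 0) * (A $ m) $$ (k, l))"
      by (simp only: sum_distrib_right[symmetric] of_real_sum[symmetric] delta)
    also have "\<dots> = (\<Sum>m\<in>UNIV. if j = m then (A $ m) $$ (k, l) else 0)"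
      by (intro sum.cong) auto
    finally show "(A $ j) $$ (k, l)
        = (\<Sum>i\<in>I. complex_of_real (c i $ j) * real_comb s (w i) A $$ (k, l))"
      by simp
  qed
qed

section \<open>Hyperplanes and salient cones\<close>

lemma linear_hyperplane_normal:
  fixes H :: "(real ^ 'd) set"
  assumes "linear_hyperplane H"
  obtains a where "H = {x. a \<bullet> x = 0}"
proof -
  have H: "Real_Vector_Spaces.subspace H" "dim H + 1 = DIM(real ^ 'd)"
    using assms by (auto simp: linear_hyperplane_def)
  obtain a where a: "a \<noteq> 0" "span H \<subseteq> {x. a \<bullet> x = 0}"
    using lowdim_subset_hyperplane[of H] H(2) by auto
  \<comment> \<open>Both subspaces have codimension one, so the inclusion is an equality.\<close>
  have "H = {x. a \<bullet> x = 0}"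
    using a H by (intro subspace_dim_equal)
      (auto simp: subspace_hyperplane dim_hyperplane dest: span_base)
  then show ?thesis ..
qed

text \<open>Otherwise a ball around the origin, hence some nonzero vector together with its
  negative, would lie in \<open>C\<close>.\<close>

lemma salient_interior_nonzero:
  fixes C :: "(real ^ 'd) set"
  assumes "salient C" "u \<in> interior C"
  shows "u \<noteq> 0"
proof
  assume "u = 0"
  then obtain e where e: "e > 0" "ball 0 e \<subseteq> C"
    using assms(2) mem_interior by blast
  fix i :: 'd
  let ?x = "(e / 2) *\<^sub>R axis i 1 :: real ^ 'd"
  have "norm ?x < e"
    using e(1) by simp
  then have "?x \<in> C" "- ?x \<in> C"
    using e(2) by (auto simp: subset_iff)
  then have "?x \<in> C \<inter> uminus ` C"
    by (metis IntI add.inverse_inverse imageI)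
  then show False
    using assms(1) e(1) unfolding salient_def by simp
qed

text \<open>As a nonzero point of \<open>C\<close>, \<open>u\<close> is off \<open>H\<close>, so a
  normal of \<open>H\<close> can be rescaled to take the value 1 at \<open>u\<close>.\<close>

lemma salient_cone_normal:
  fixes C H :: "(real ^ 'd) set"
  assumes C: "convex_cone C" "salient C"
    and "linear_hyperplane H" "H \<inter> C = {0}" and u: "u \<in> interior C"
  obtains a where "H = {x. a \<bullet> x = 0}" "a \<bullet> u = 1" "\<And>x. x \<in> C \<Longrightarrow> x \<noteq> 0 \<Longrightarrow> 0 < a \<bullet> x"
proof -
  obtain b where b: "H = {x. b \<bullet> x = 0}"
    using linear_hyperplane_normal assms(3) by blast
  have uC: "u \<in> C" and u0: "u \<noteq> 0"
    using u interior_subset salient_interior_nonzero[OF C(2) u] by auto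
  then have bu: "b \<bullet> u \<noteq> 0"
    using assms(4) b by auto
  define a where "a = b /\<^sub>R (b \<bullet> u)"
  have Ha: "H = {x. a \<bullet> x = 0}" and au: "a \<bullet> u = 1"
    using b bu by (auto simp: a_def)
  have "0 < a \<bullet> x" if x: "x \<in> C" "x \<noteq> 0" for x
  proof (rule ccontr)
    assume "\<not> 0 < a \<bullet> x"
    then have nonpos: "0 \<le> - (a \<bullet> x)"
      by simp
    have mu: "(- (a \<bullet> x)) *\<^sub>R u \<in> C"
      using convex_cone_scaleR[OF C(1) nonpos uC] by simp
    \<comment> \<open>Moving from \<open>x\<close> in direction \<open>u\<close> stays in
      \<open>C\<close> and reaches \<open>H\<close>, where only the origin is available. So
      \<open>x\<close> is a nonpositive multiple of \<open>u\<close>.\<close>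
    have "x + (- (a \<bullet> x)) *\<^sub>R u \<in> H \<inter> C"
      using convex_cone_add[OF C(1) x(1) mu] Ha au by (simp add: inner_add_right inner_diff_right)
    then have "x = (a \<bullet> x) *\<^sub>R u"
      using assms(4) by simp
    then have "- x \<in> C"
      using mu by (metis scaleR_minus_left)
    then have "x \<in> C \<inter> uminus ` C"
      using x(1) by (metis IntI add.inverse_inverse imageI)
    then show False
      using C(2) x(2) unfolding salient_def by blast
  qed
  with Ha au show ?thesis
    using that by blast
qed

text \<open>By compactness \<open>a\<close> has a positive minimum \<open>m\<close> on the unit
  vectors of \<open>C\<close>; homogeneity gives the bound with \<open>R = 1 / m\<close>.\<close>

lemma norm_le_inner_on_cone:
  fixes C :: "'a::euclidean_space set"
  assumes "closed C" "conic C" and pos: "\<And>x. x \<in> C \<Longrightarrow> x \<noteq> 0 \<Longrightarrow> 0 < a \<bullet> x"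
  obtains R where "R > 0" "\<And>x. x \<in> C \<Longrightarrow> norm x \<le> R * (a \<bullet> x)"
proof -
  have "\<exists>m>0. \<forall>x\<in>C \<inter> sphere 0 1. m \<le> a \<bullet> x"
  proof (cases "C \<inter> sphere 0 1 = {}")
    case False
    have "compact (C \<inter> sphere 0 1)"
      by (simp add: assms(1) closed_Int_compact)
    then obtain z where "z \<in> C \<inter> sphere 0 1" "\<forall>x\<in>C \<inter> sphere 0 1. a \<bullet> z \<le> a \<bullet> x"
      using continuous_attains_inf[of "C \<inter> sphere 0 1" "\<lambda>x. a \<bullet> x"] False
        continuous_on_inner[OF continuous_on_const continuous_on_id]
      by blast
    moreover have "0 < a \<bullet> z"
      using calculation(1) by (intro pos) auto
    ultimately show ?thesis
      by blast
  \<comment> \<open>Without unit vectors in \<open>C\<close> the bound is vacuous, and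
    \<open>m = 1\<close> serves.\<close>
  qed (auto intro: exI[of _ 1])
  then obtain m where m: "m > 0" "\<And>x. x \<in> C \<inter> sphere 0 1 \<Longrightarrow> m \<le> a \<bullet> x"
    by blast
  have "norm x \<le> (1 / m) * (a \<bullet> x)" if "x \<in> C" for x
  proof (cases "x = 0")
    case False
    have "x /\<^sub>R norm x \<in> C \<inter> sphere 0 1"
      using assms(2) that False by (auto simp: conic_def)
    from m(2)[OF this] show ?thesis
      using False m(1) by (simp add: field_simps)
  qed simp
  with m(1) show ?thesis
    by (intro that[of "1 / m"]) auto
qed

theorem proposition5p6:
  fixes C H :: "(real ^ 'd) set" and u :: "real ^ 'd"
  assumes "closed C" and "convex_cone C" and "salient C" and "interior C \<noteq> {}"
    and "linear_hyperplane H" and "H \<inter> C = {0}"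
    and "u \<in> interior C"
  shows "\<exists>\<nu>>0. \<forall>s\<ge>1. cone_max (scaled_cone H u \<nu> C) s \<subseteq> cone_min C s"
proof -
  obtain a where H: "H = {x. a \<bullet> x = 0}" and au: "a \<bullet> u = 1"
    and pos: "\<And>x. x \<in> C \<Longrightarrow> x \<noteq> 0 \<Longrightarrow> 0 < a \<bullet> x"
    using salient_cone_normal[OF assms(2,3,5,6,7)] by blast
  obtain R0 where R0: "R0 > 0" "\<And>x. x \<in> C \<Longrightarrow> norm x \<le> R0 * (a \<bullet> x)"
    using norm_le_inner_on_cone[OF assms(1) _ pos] assms(2)
    by (auto simp: convex_cone_def)
  \<comment> \<open>On the slice \<open>a \<bullet> x = 1\<close> of \<open>C\<close> the norm is at
    most \<open>R0\<close>, so the distance from \<open>u\<close> is at most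
    \<open>R\<close>.\<close>
  define R where "R = R0 + norm u"
  have R: "R > 0"
    using R0(1) by (simp add: R_def add_pos_nonneg)
  have dist_u: "\<bar>(x - u) $ j\<bar> \<le> R" if "x \<in> C" "a \<bullet> x = 1" for x j
    using R0(2)[OF that(1)] component_le_norm_cart[of "x - u" j] norm_triangle_ineq4[of x u]
    by (simp add: R_def that(2))
  obtain \<delta> where \<delta>: "\<delta> > 0" "cball u \<delta> \<subseteq> C"
    using assms(7) mem_interior_cball by blast
  define d where "d = real CARD('d)"
  have d: "d > 0"
    by (simp add: d_def)
  \<comment> \<open>This makes \<open>\<nu> * R / \<delta>\<close> equal to \<open>1 / d\<close>,
    the share of \<open>a \<bullet> y = 1\<close> given to each coordinate in
    \<open>w\<close>.\<close>
  define \<nu> where "\<nu> = \<delta> / (d * R)"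
  have \<nu>: "\<nu> > 0" "\<nu> * R = \<delta> / d"
    using \<delta>(1) d R by (auto simp: \<nu>_def)
  define sg :: "bool \<Rightarrow> real" where "sg b = (if b then 1 else -1)" for b
  \<comment> \<open>These are the vertices of a cross-polytope centred at \<open>u\<close>,
    inscribed in the ball of radius \<open>\<delta>\<close>.\<close>
  define c where "c = (\<lambda>(j :: 'd, b). u + (sg b * \<delta>) *\<^sub>R axis j 1)"
  \<comment> \<open>The functional \<open>axis j 1 - (u $ j) *\<^sub>R a\<close> reads off
    coordinate \<open>j\<close> of \<open>y - (a \<bullet> y) *\<^sub>R u\<close>, the projection of
    \<open>y\<close> to \<open>H\<close> along \<open>u\<close>.\<close>
  define w where "w = (\<lambda>(j :: 'd, b).
    (1 / 2) *\<^sub>R ((1 / d) *\<^sub>R a + (sg b / \<delta>) *\<^sub>R (axis j 1 - (u $ j) *\<^sub>R a)))"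
  have w: "w (j, b) \<bullet> y = ((a \<bullet> y) / d + sg b * (y $ j - u $ j * (a \<bullet> y)) / \<delta>) / 2" for j b y
    by (simp add: w_def inner_axis' diff_divide_distrib algebra_simps)
  have c: "c i \<in> C" for i
    using \<delta> by (auto simp: c_def sg_def dist_norm subset_iff split: prod.split)
  have w_nonneg: "0 \<le> w i \<bullet> y" if "y \<in> scaled_cone H u \<nu> C" for i y
  proof -
    obtain j b where i: "i = (j, b)"
      by (cases i)
    \<comment> \<open>A half-space is a convex cone, so nonnegativity need only be checked on the
      generators \<open>u + \<nu> *\<^sub>R h\<close> with \<open>h\<close> in
      \<open>H\<close>.\<close>
    have "(\<lambda>x. u + \<nu> *\<^sub>R (x - u)) ` (C \<inter> (+) u ` H) \<subseteq> {y. 0 \<le> w i \<bullet> y}"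
    proof clarsimp
      fix h
      assume h: "u + h \<in> C" "h \<in> H"
      then have ah: "a \<bullet> h = 0"
        by (simp add: H)
      have "\<bar>\<nu> * h $ j\<bar> \<le> \<nu> * R"
        using dist_u[OF h(1), of j] ah au \<nu>(1) by (simp add: inner_add_right abs_mult)
      then have "\<bar>\<nu> * h $ j\<bar> / \<delta> \<le> 1 / d"
        using \<delta>(1) unfolding \<nu>(2) by (simp add: field_simps)
      then have "\<bar>sg b * (\<nu> * h $ j) / \<delta>\<bar> \<le> 1 / d"
        using \<delta>(1) by (simp add: sg_def abs_mult)
      then have "0 \<le> 1 / d + sg b * (\<nu> * h $ j) / \<delta>"
        using abs_le_D2 diff_ge_0_iff_ge diff_minus_eq_add by metis
      then show "0 \<le> w i \<bullet> (u + \<nu> *\<^sub>R h)"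
        unfolding i w using ah au by (simp add: inner_add_right)
    qed
    moreover have "convex_cone {y. 0 \<le> w i \<bullet> y}"
      using convex_cone_halfspace_ge[of "w i"] by simp
    ultimately have "scaled_cone H u \<nu> C \<subseteq> {y. 0 \<le> w i \<bullet> y}"
      unfolding scaled_cone_def by (rule hull_minimal)
    then show ?thesis
      using that by blast
  qed
  have "(\<Sum>i\<in>UNIV. (w i \<bullet> y) *\<^sub>R c i) = y" for y
  proof -
    have "(\<Sum>i\<in>UNIV. (w i \<bullet> y) *\<^sub>R c i)
        = (\<Sum>j\<in>UNIV. \<Sum>b\<in>UNIV. (w (j, b) \<bullet> y) *\<^sub>R c (j, b))"
      by (simp add: sum.cartesian_product flip: UNIV_Times_UNIV)
    \<comment> \<open>For two opposite vertices the coefficients add up to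
      \<open>(a \<bullet> y) / d\<close>, the weight of \<open>u\<close>. Their difference times
      \<open>\<delta>\<close> is the weight of \<open>axis j 1\<close>.\<close>
    also have "\<dots> = (\<Sum>j\<in>UNIV. ((a \<bullet> y) / d) *\<^sub>R u + (y $ j - u $ j * (a \<bullet> y)) *\<^sub>R axis j 1)"
    proof (intro sum.cong refl)
      fix j
      show "(\<Sum>b\<in>UNIV. (w (j, b) \<bullet> y) *\<^sub>R c (j, b))
          = ((a \<bullet> y) / d) *\<^sub>R u + (y $ j - u $ j * (a \<bullet> y)) *\<^sub>R axis j 1"
        using \<delta>(1) d
        by (simp add: w c_def sg_def UNIV_bool Finite_Cartesian_Product.vec_eq_iff) (simp add: field_simps)
    qed
    also have "\<dots> = (a \<bullet> y) *\<^sub>R u + (y - (a \<bullet> y) *\<^sub>R u)"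
      using d by (simp add: sum.distrib sum_constant_scaleR Finite_Cartesian_Product.vec_eq_iff
          axis_def d_def if_distrib del: sum_constant cong: if_cong)
    finally show ?thesis
      by simp
  qed
  \<comment> \<open>Neither \<open>c\<close>, \<open>w\<close> nor \<open>\<nu>\<close> involves
    \<open>s\<close>, so the same \<open>\<nu>\<close> works for every matrix size.\<close>
  then show ?thesis
    using \<nu>(1) c w_nonneg
    by (intro exI[of _ \<nu>] conjI allI impI cone_max_subset_cone_min_factor[of UNIV c C _ w]) auto
qed

end
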